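(* Let $n\ge1$ and $\sigma>0$. The Fourier transform of the texture kernel $\Phi_\sigma=\sigma\Delta\gamma_\sigma$ on $\mathbb{R}^n$ is given by $$\widehat{\Phi_\sigma}(\xi)=-\sigma|\xi|^2\exp\!\left(-\frac{\sigma^2|\xi|^2}{2}\right),\qquad \xi\in\mathbb{R}^n.$$
   Context: $\gamma_\sigma(x)=(2\pi\sigma^2)^{-n/2}\exp(-|x|^2/(2\sigma^2))$ is the Gaussian kernel on $\mathbb{R}^n$, $\Delta$ is the spatial Laplacian, and the Fourier transform is $\hat u(\xi)=\int_{\mathbb{R}^n}u(x)e^{-ix\cdot\xi}\,dx$. *)

theory Defs
  imports "HOL-Analysis.Analysis"
begin

definition gaussian_kernel :: "real \<Rightarrow> real ^ 'n::finite \<Rightarrow> real" where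
  "gaussian_kernel \<sigma> x =
     (2 * pi * \<sigma>\<^sup>2) powr (- (real CARD('n) / 2)) * exp (- (norm x)\<^sup>2 / (2 * \<sigma>\<^sup>2))"

definition partial_deriv :: "'n::finite \<Rightarrow> (real ^ 'n \<Rightarrow> real) \<Rightarrow> real ^ 'n \<Rightarrow> real" where
  "partial_deriv i f x = deriv (\<lambda>t. f (x + t *\<^sub>R axis i 1)) 0"

definition laplacian :: "(real ^ 'n::finite \<Rightarrow> real) \<Rightarrow> real ^ 'n \<Rightarrow> real" where
  "laplacian f x = (\<Sum>i\<in>UNIV. partial_deriv i (partial_deriv i f) x)"

definition texture_kernel :: "real \<Rightarrow> real ^ 'n::finite \<Rightarrow> real" where
  "texture_kernel \<sigma> x = \<sigma> * laplacian (gaussian_kernel \<sigma>) x"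

(* The Bochner integral is 0 on non-integrable functions. As the phase factor has modulus 1,
   the integrand is integrable for one \<xi> iff it is for all \<xi>, so a transform that is
   nonzero somewhere already certifies that u is integrable. *)
definition fourier_transform :: "(real ^ 'n::finite \<Rightarrow> complex) \<Rightarrow> real ^ 'n \<Rightarrow> complex" where
  "fourier_transform u \<xi> = (LINT x|lborel. u x * exp (- (\<i> * complex_of_real (x \<bullet> \<xi>))))"

end

theory Submission
  imports Defs "HOL-Probability.Characteristic_Functions" "HOL-Real_Asymp.Real_Asymp"
begin

text \<open>Everything reduces to dimension one. With g the normal density of mean 0 and standard
  deviation \<sigma>, the Gaussian kernel at x is the product of the g(x_j), and the phase factor is
  the product of the exp(-i x_j \<xi>_j). Two derivatives along axis i only turn the i-th factor g
  into g'' (\<open>partial_deriv2_gaussian_kernel\<close>), so every summand of the Laplacian still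
  separates variables.

  By Fubini (\<open>integral_lborel_prod_vec\<close>) the transform of such a summand is a product
  of one-dimensional transforms. The factors j \<noteq> i give exp(-\<sigma>^2 \<xi>_j^2 / 2), from
  the characteristic function of the normal law (\<open>fourier_normal_density\<close>). The factor
  i acquires an extra -\<xi>_i^2 (\<open>fourier_normal_density_deriv2\<close>), because the
  integral of (g'' + \<xi>_i^2 g) times the phase vanishes. The exponentials multiply to the same
  function of |\<xi>| for every i, and summing over i turns the \<xi>_i^2 into |\<xi>|^2.\<close>

lemma
  fixes f :: "'a::euclidean_space \<Rightarrow> real \<Rightarrow> 'b::{real_normed_field, banach, second_countable_topology}"
  assumes f: "\<And>b. b \<in> Basis \<Longrightarrow> integrable lborel (f b)"
  shows integrable_lborel_prod_Basis: "integrable lborel (\<lambda>x. \<Prod>b\<in>Basis. f b (x \<bullet> b))"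
    and integral_lborel_prod_Basis:
      "(LINT x|lborel. (\<Prod>b\<in>Basis. f b (x \<bullet> b))) = (\<Prod>b\<in>Basis. (LINT t|lborel. f b t))"
proof -
  interpret product_sigma_finite "\<lambda>b::'a. lborel :: real measure"
    by (simp add: product_sigma_finite_def sigma_finite_lborel)
  have [measurable]: "f b \<in> borel_measurable borel" if "b \<in> Basis" for b
    using borel_measurable_integrable[OF f[OF that]] by simp
  have eq: "(\<Prod>b\<in>Basis. f b ((\<Sum>c\<in>Basis. y c *\<^sub>R c) \<bullet> b)) = (\<Prod>b\<in>Basis. f b (y b))" for y :: "'a \<Rightarrow> real"
    by (intro prod.cong) simp_all
  have [measurable]: "(\<lambda>x. \<Prod>b\<in>Basis. f b (x \<bullet> b)) \<in> borel_measurable borel"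
    by (intro borel_measurable_prod) measurable
  show "integrable lborel (\<lambda>x. \<Prod>b\<in>Basis. f b (x \<bullet> b))"
    by (subst lborel_eq, subst integrable_distr_eq)
      (measurable, simp add: eq product_integrable_prod f)
  show "(LINT x|lborel. (\<Prod>b\<in>Basis. f b (x \<bullet> b))) = (\<Prod>b\<in>Basis. (LINT t|lborel. f b t))"
    by (subst lborel_eq, subst integral_distr)
      (measurable, simp add: eq product_integral_prod f)
qed

lemma prod_Basis_vec:
  "(\<Prod>b\<in>(Basis :: (real ^ 'n::finite) set). h b) = (\<Prod>i\<in>UNIV. h (axis i 1))"
proof -
  have Basis: "(Basis :: (real ^ 'n) set) = range (\<lambda>i. axis i 1)"
    by (auto simp: Basis_vec_def)
  have "inj (\<lambda>i::'n. axis i (1::real))"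
    by (auto simp: inj_on_def axis_eq_axis)
  then show ?thesis
    unfolding Basis by (simp add: prod.reindex)
qed

lemma
  fixes f :: "'n::finite \<Rightarrow> real \<Rightarrow> 'b::{real_normed_field, banach, second_countable_topology}"
  assumes f: "\<And>i. integrable lborel (f i)"
  shows integrable_lborel_prod_vec:
      "integrable lborel (\<lambda>x::real^'n. \<Prod>i\<in>UNIV. f i (x $ i))"
    and integral_lborel_prod_vec:
      "(LINT x|(lborel :: (real^'n) measure). (\<Prod>i\<in>UNIV. f i (x $ i))) = (\<Prod>i\<in>UNIV. (LINT t|lborel. f i t))"
proof -
  \<comment> \<open>The family is moved from indices to basis vectors. Outside the axis vectors
    \<open>THE\<close> is unspecified, but g b is still some member of the family f, hence
    integrable.\<close>
  define g where "g b = f (THE i. b = axis i 1)" for b :: "real ^ 'n"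
  have g: "g (axis i 1) = f i" for i
    by (simp add: g_def axis_eq_axis)
  have "integrable lborel (g b)" for b
    by (simp add: g_def f)
  note prod_ints = integrable_lborel_prod_Basis[of g, OF this] integral_lborel_prod_Basis[of g, OF this]
  show "integrable lborel (\<lambda>x::real^'n. \<Prod>i\<in>UNIV. f i (x $ i))"
    using prod_ints(1) by (simp add: prod_Basis_vec g inner_axis)
  show "(LINT x|(lborel :: (real^'n) measure). (\<Prod>i\<in>UNIV. f i (x $ i))) = (\<Prod>i\<in>UNIV. (LINT t|lborel. f i t))"
    using prod_ints(2) by (simp add: prod_Basis_vec g inner_axis)
qed

lemma gaussian_kernel_eq_prod:
  fixes x :: "real ^ 'n::finite"
  assumes "\<sigma> > 0"
  shows "gaussian_kernel \<sigma> x = (\<Prod>i\<in>UNIV. normal_density 0 \<sigma> (x $ i))"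
proof -
  define c where "c = 2 * pi * \<sigma>\<^sup>2"
  have c: "c > 0" using assms by (simp add: c_def)
  have "c powr (- (real CARD('n) / 2)) = (c powr (- 1 / 2)) powr real CARD('n)"
    by (simp add: powr_powr)
  also have "\<dots> = (1 / sqrt c) ^ CARD('n)"
    using c by (simp add: powr_realpow powr_minus powr_half_sqrt divide_simps)
  finally have pow: "c powr (- (real CARD('n) / 2)) = (1 / sqrt c) ^ CARD('n)" .
  have "(norm x)\<^sup>2 = (\<Sum>i\<in>UNIV. (x $ i)\<^sup>2)"
    by (simp add: norm_vec_def L2_set_def sum_nonneg)
  then have "exp (- (norm x)\<^sup>2 / (2 * \<sigma>\<^sup>2)) = (\<Prod>i\<in>UNIV. exp (- (x $ i)\<^sup>2 / (2 * \<sigma>\<^sup>2)))"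
    by (simp add: exp_sum[symmetric] sum_divide_distrib sum_negf)
  then show ?thesis
    by (simp add: gaussian_kernel_def normal_density_def pow[unfolded c_def] prod.distrib prod_dividef power_divide)
qed

lemma has_real_derivative_gaussian_kernel_axis:
  fixes x :: "real ^ 'n::finite"
  assumes "\<sigma> > 0"
  shows "((\<lambda>t. gaussian_kernel \<sigma> (x + t *\<^sub>R axis i 1)) has_real_derivative
    - (x $ i) / \<sigma>\<^sup>2 * gaussian_kernel \<sigma> x) (at 0)"
proof -
  \<comment> \<open>Along the line, the squared norm is a quadratic in t with linear coefficient 2
    x_i, so the exponent has derivative -x_i / \<sigma>^2 at t = 0.\<close>
  have "(norm (x + t *\<^sub>R axis i 1))\<^sup>2 = (norm x)\<^sup>2 + 2 * t * x $ i + t\<^sup>2" for t :: real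
    unfolding power2_norm_eq_inner
    by (simp add: inner_axis inner_axis' inner_add_left inner_add_right power2_eq_square algebra_simps)
  then show ?thesis
    unfolding gaussian_kernel_def using assms
    by (auto intro!: derivative_eq_intros simp: field_simps power2_eq_square)
qed

text \<open>Product rule for -x_i / \<sigma>^2 times the kernel. The point of this form is that the
  prefactor depends on x_i alone.\<close>

lemma partial_deriv2_gaussian_kernel:
  fixes x :: "real ^ 'n::finite"
  assumes "\<sigma> > 0"
  shows "partial_deriv i (partial_deriv i (gaussian_kernel \<sigma>)) x =
    ((x $ i)\<^sup>2 / \<sigma>^4 - 1 / \<sigma>\<^sup>2) * gaussian_kernel \<sigma> x"
proof -
  \<comment> \<open>The first derivative is needed as an identity of functions, since it is
    differentiated again.\<close>
  have D1: "partial_deriv i (gaussian_kernel \<sigma>) = (\<lambda>y. - (y $ i) / \<sigma>\<^sup>2 * gaussian_kernel \<sigma> y)"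
    unfolding partial_deriv_def
    by (intro ext DERIV_imp_deriv has_real_derivative_gaussian_kernel_axis assms)
  have "((\<lambda>t. - ((x + t *\<^sub>R axis i 1) $ i) / \<sigma>\<^sup>2 * gaussian_kernel \<sigma> (x + t *\<^sub>R axis i 1))
      has_real_derivative ((x $ i)\<^sup>2 / \<sigma>^4 - 1 / \<sigma>\<^sup>2) * gaussian_kernel \<sigma> x) (at 0)"
    using assms
    by (auto intro!: derivative_eq_intros has_real_derivative_gaussian_kernel_axis
        simp: field_simps power2_eq_square power4_eq_xxxx)
  then show ?thesis
    unfolding D1 by (subst partial_deriv_def) (rule DERIV_imp_deriv)
qed

text \<open>The phase has modulus 1, so f itself dominates.\<close>

lemma integrable_mult_exp_imaginary:
  fixes f :: "real \<Rightarrow> real"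
  assumes f: "integrable lborel f"
  shows "integrable lborel (\<lambda>x. complex_of_real (f x) * exp (- (\<i> * complex_of_real (x * \<xi>))))"
proof (rule Bochner_Integration.integrable_bound[OF f])
  have [measurable]: "f \<in> borel_measurable borel"
    using borel_measurable_integrable[OF f] by simp
  have "(\<lambda>x. exp (- (\<i> * complex_of_real (x * \<xi>)))) \<in> borel_measurable borel"
    by (intro borel_measurable_continuous_onI continuous_intros)
  then show "(\<lambda>x. complex_of_real (f x) * exp (- (\<i> * complex_of_real (x * \<xi>)))) \<in> borel_measurable lborel"
    by measurable
qed (simp add: norm_mult)

text \<open>Substituting \<sigma> x for x reduces to the standard normal law, whose characteristic
  function is known. It is evaluated at -\<sigma> \<xi>, because \<open>char\<close> integrates
  against exp(i t x) whereas the transform has a minus sign.\<close>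

lemma fourier_normal_density:
  assumes "\<sigma> > 0"
  shows "(LINT x|lborel. complex_of_real (normal_density 0 \<sigma> x) * exp (- (\<i> * complex_of_real (x * \<xi>)))) =
    complex_of_real (exp (- (\<sigma>\<^sup>2 * \<xi>\<^sup>2) / 2))"
proof -
  have density: "complex_of_real \<sigma> * complex_of_real (normal_density 0 \<sigma> (\<sigma> * x)) =
      complex_of_real (std_normal_density x)" for x
    using assms by (simp add: normal_density_def real_sqrt_mult power_mult_distrib)
  have "complex_of_real (exp (- (\<sigma>\<^sup>2 * \<xi>\<^sup>2) / 2)) = char std_normal_distribution (- (\<sigma> * \<xi>))"
    by (simp add: char_std_normal_distribution power_mult_distrib)
  also have "\<dots> = (LINT x|lborel. std_normal_density x *\<^sub>R iexp (- (\<sigma> * \<xi>) * x))"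
    unfolding char_def by (subst integral_density) auto
  also have "\<dots> = \<bar>\<sigma>\<bar> *\<^sub>R (LINT x|lborel. complex_of_real (normal_density 0 \<sigma> (0 + \<sigma> * x)) *
      exp (- (\<i> * complex_of_real ((0 + \<sigma> * x) * \<xi>))))"
    using assms unfolding integral_scaleR_right[symmetric]
    by (intro Bochner_Integration.integral_cong) (simp_all add: scaleR_conv_of_real density[symmetric] mult_ac)
  also have "\<dots> = (LINT x|lborel. complex_of_real (normal_density 0 \<sigma> x) * exp (- (\<i> * complex_of_real (x * \<xi>))))"
    using assms by (intro lborel_integral_real_affine[symmetric]) simp
  finally show ?thesis ..
qed

lemma integrable_normal_density_deriv2:
  assumes "\<sigma> > 0"
  shows "integrable lborel (\<lambda>x. (x\<^sup>2 / \<sigma>^4 - 1 / \<sigma>\<^sup>2) * normal_density 0 \<sigma> x)"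
proof -
  \<comment> \<open>A combination of the second and zeroth moments; \<open>x - 0\<close> exhibits
    the mean 0 in the moment lemma.\<close>
  have "integrable lborel (\<lambda>x. normal_density 0 \<sigma> x * (x - 0)\<^sup>2 * (1 / \<sigma>^4) - normal_density 0 \<sigma> x * (1 / \<sigma>\<^sup>2))"
    using assms by (intro Bochner_Integration.integrable_diff integrable_mult_left
        integrable_normal_moment integrable_normal_density)
  then show ?thesis
    by (simp add: algebra_simps)
qed

text \<open>Two integrations by parts at once: the antiderivative below is
  \<open>(g' + \<i> \<xi> g) e\<close> with \<open>g\<close> the density and \<open>e\<close> the phase factor, and its derivative is
  \<open>(g'' + \<xi>\<^sup>2 g) e\<close>.\<close>
lemma fourier_normal_density_deriv2:
  assumes "\<sigma> > 0"
  shows "(LINT x|lborel. complex_of_real ((x\<^sup>2 / \<sigma>^4 - 1 / \<sigma>\<^sup>2) * normal_density 0 \<sigma> x) *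
      exp (- (\<i> * complex_of_real (x * \<xi>)))) =
    - complex_of_real (\<xi>\<^sup>2 * exp (- (\<sigma>\<^sup>2 * \<xi>\<^sup>2) / 2))"
proof -
  let ?g = "normal_density 0 \<sigma>"
  let ?e = "\<lambda>x. exp (- (\<i> * complex_of_real (x * \<xi>)))"
  define G where "G x = (complex_of_real (- x / \<sigma>\<^sup>2 * ?g x) + \<i> * \<xi> * complex_of_real (?g x)) * ?e x" for x
  define h where "h x = complex_of_real ((x\<^sup>2 / \<sigma>^4 - 1 / \<sigma>\<^sup>2) * ?g x) * ?e x + \<xi>\<^sup>2 * (complex_of_real (?g x) * ?e x)" for x
  have int1: "integrable lborel (\<lambda>x. complex_of_real ((x\<^sup>2 / \<sigma>^4 - 1 / \<sigma>\<^sup>2) * ?g x) * ?e x)"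
    by (intro integrable_mult_exp_imaginary integrable_normal_density_deriv2 assms)
  have int2: "integrable lborel (\<lambda>x. complex_of_real (?g x) * ?e x)"
    by (intro integrable_mult_exp_imaginary integrable_normal_density assms)
  have int_h: "integrable lborel h"
    unfolding h_def by (intro Bochner_Integration.integrable_add int1 integrable_mult_right int2)
  have dg: "(?g has_real_derivative - x / \<sigma>\<^sup>2 * ?g x) (at x)" for x
    unfolding normal_density_def using assms
    by (auto intro!: derivative_eq_intros simp: field_simps power2_eq_square)
  have dg': "((\<lambda>x. - x / \<sigma>\<^sup>2 * ?g x) has_real_derivative (x\<^sup>2 / \<sigma>^4 - 1 / \<sigma>\<^sup>2) * ?g x) (at x)" for x
    using assms
    by (auto intro!: derivative_eq_intros dg simp: field_simps power2_eq_square power4_eq_xxxx)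
  \<comment> \<open>The phase is differentiated as a holomorphic function of z and then restricted
    to the real line.\<close>
  have "((\<lambda>z. exp (- (\<i> * (z * \<xi>)))) has_field_derivative
      - \<i> * \<xi> * exp (- (\<i> * (of_real x * \<xi>)))) (at (complex_of_real x))" for x
    by (auto intro!: derivative_eq_intros)
  from has_vector_derivative_real_field[OF this]
  have de: "(?e has_vector_derivative - \<i> * \<xi> * ?e x) (at x)" for x
    by simp
  have dG: "(G has_vector_derivative h x) (at x)" for x
  proof -
    note vd = has_real_derivative_iff_has_vector_derivative[THEN iffD1]
    have "((\<lambda>x. complex_of_real (- x / \<sigma>\<^sup>2 * ?g x) + \<i> * \<xi> * complex_of_real (?g x)) has_vector_derivative
        complex_of_real ((x\<^sup>2 / \<sigma>^4 - 1 / \<sigma>\<^sup>2) * ?g x) + \<i> * \<xi> * complex_of_real (- x / \<sigma>\<^sup>2 * ?g x)) (at x)"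
      by (intro has_vector_derivative_add has_vector_derivative_mult_right
          has_vector_derivative_of_real vd dg dg')
    from has_vector_derivative_mult[OF this de] show ?thesis
      unfolding G_def h_def by (simp add: algebra_simps power2_eq_square)
  qed
  have cont_h: "isCont h x" for x
    unfolding h_def normal_density_def using assms by (intro continuous_intros) auto
  \<comment> \<open>Passing to the modulus removes the phase and leaves a real bound, polynomial
    growth times a Gaussian, whose limits \<open>real_asymp\<close> can compute.\<close>
  have norm_G: "norm (G x) \<le> \<bar>x\<bar> / \<sigma>\<^sup>2 * ?g x + \<bar>\<xi>\<bar> * ?g x" for x
    unfolding G_def norm_mult
    using norm_triangle_ineq[of "complex_of_real (- x / \<sigma>\<^sup>2 * ?g x)" "\<i> * \<xi> * complex_of_real (?g x)"]
    by (simp add: norm_mult norm_divide norm_power abs_mult)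
  have "((\<lambda>x. \<bar>x\<bar> / \<sigma>\<^sup>2 * ?g x + \<bar>\<xi>\<bar> * ?g x) \<longlongrightarrow> 0) at_top"
    "((\<lambda>x. \<bar>x\<bar> / \<sigma>\<^sup>2 * ?g x + \<bar>\<xi>\<bar> * ?g x) \<longlongrightarrow> 0) at_bot"
    unfolding normal_density_def using assms by real_asymp+
  then have lim: "(G \<longlongrightarrow> 0) at_top" "(G \<longlongrightarrow> 0) at_bot"
    by (auto intro: Lim_null_comparison[OF always_eventually[OF allI[OF norm_G]]])
  \<comment> \<open>Fundamental theorem of calculus on the whole line: h is continuous and
    integrable, and the boundary terms are the two vanishing limits of G.\<close>
  have "(LBINT x=-\<infinity>..\<infinity>. h x) = 0 - 0"
    by (rule interval_integral_FTC_integrable)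
      (use dG cont_h lim int_h in \<open>auto simp: ereal_tendsto_simps einterval_eq_UNIV set_integrable_def\<close>)
  then have "(LINT x|lborel. h x) = 0"
    by (simp add: interval_lebesgue_integral_def einterval_eq_UNIV set_lebesgue_integral_def)
  then have "(LINT x|lborel. complex_of_real ((x\<^sup>2 / \<sigma>^4 - 1 / \<sigma>\<^sup>2) * ?g x) * ?e x) +
      \<xi>\<^sup>2 * (LINT x|lborel. complex_of_real (?g x) * ?e x) = 0"
    unfolding h_def
    by (subst (asm) Bochner_Integration.integral_add) (use int1 int2 in auto)
  then show ?thesis
    unfolding fourier_normal_density[OF assms] by (simp add: add_eq_0_iff2)
qed

text \<open>Both claims come from writing the integrand as a product of one-variable functions.
  Integrability is recorded separately because it justifies splitting the sum that defines the
  Laplacian.\<close>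

lemma
  fixes \<xi> :: "real ^ 'n::finite"
  assumes "\<sigma> > 0"
  shows integrable_partial_deriv2_gaussian_kernel:
    "integrable lborel (\<lambda>x. complex_of_real (partial_deriv i (partial_deriv i (gaussian_kernel \<sigma>)) x) *
      exp (- (\<i> * complex_of_real (x \<bullet> \<xi>))))"
  and fourier_transform_partial_deriv2_gaussian_kernel:
    "fourier_transform (\<lambda>x. complex_of_real (partial_deriv i (partial_deriv i (gaussian_kernel \<sigma>)) x)) \<xi> =
      - complex_of_real ((\<xi> $ i)\<^sup>2 * exp (- (\<sigma>\<^sup>2 * (norm \<xi>)\<^sup>2) / 2))"
proof -
  \<comment> \<open>The one-dimensional integrand in coordinate j: g'' times the phase for j = i,
    and g times the phase otherwise.\<close>
  define u where "u j t = complex_of_real ((if j = i then t\<^sup>2 / \<sigma>^4 - 1 / \<sigma>\<^sup>2 else 1) * normal_density 0 \<sigma> t) *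
    exp (- (\<i> * complex_of_real (t * \<xi> $ j)))" for j t
  have int_u: "integrable lborel (u j)" for j
    unfolding u_def using assms
    by (intro integrable_mult_exp_imaginary, cases "j = i")
      (simp_all add: integrable_normal_density_deriv2)
  have integral_u: "integral\<^sup>L lborel (u j) =
      (if j = i then - complex_of_real ((\<xi> $ i)\<^sup>2) else 1) * complex_of_real (exp (- (\<sigma>\<^sup>2 * (\<xi> $ j)\<^sup>2) / 2))" for j
    using fourier_normal_density_deriv2[OF assms, of "\<xi> $ j"] fourier_normal_density[OF assms, of "\<xi> $ j"]
    by (cases "j = i") (simp_all add: u_def[abs_def])
  have phase: "exp (- (\<i> * complex_of_real (x \<bullet> \<xi>))) = (\<Prod>j\<in>UNIV. exp (- (\<i> * complex_of_real (x $ j * \<xi> $ j))))" for x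
    by (simp add: inner_vec_def exp_sum[symmetric] sum_negf sum_distrib_left)
  have eq: "complex_of_real (partial_deriv i (partial_deriv i (gaussian_kernel \<sigma>)) x) *
      exp (- (\<i> * complex_of_real (x \<bullet> \<xi>))) = (\<Prod>j\<in>UNIV. u j (x $ j))" for x
    unfolding partial_deriv2_gaussian_kernel[OF assms] gaussian_kernel_eq_prod[OF assms] phase u_def
    by (simp add: prod.distrib if_distrib[of complex_of_real] cong: if_cong)
  show "integrable lborel (\<lambda>x. complex_of_real (partial_deriv i (partial_deriv i (gaussian_kernel \<sigma>)) x) *
      exp (- (\<i> * complex_of_real (x \<bullet> \<xi>))))"
    unfolding eq by (intro integrable_lborel_prod_vec int_u)
  have "(norm \<xi>)\<^sup>2 = (\<Sum>j\<in>UNIV. (\<xi> $ j)\<^sup>2)"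
    by (simp add: norm_vec_def L2_set_def sum_nonneg)
  then have "exp (- (\<sigma>\<^sup>2 * (norm \<xi>)\<^sup>2) / 2) = (\<Prod>j\<in>UNIV. exp (- (\<sigma>\<^sup>2 * (\<xi> $ j)\<^sup>2) / 2))"
    by (simp add: exp_sum[symmetric] sum_divide_distrib sum_negf sum_distrib_left)
  then show "fourier_transform (\<lambda>x. complex_of_real (partial_deriv i (partial_deriv i (gaussian_kernel \<sigma>)) x)) \<xi> =
      - complex_of_real ((\<xi> $ i)\<^sup>2 * exp (- (\<sigma>\<^sup>2 * (norm \<xi>)\<^sup>2) / 2))"
    unfolding fourier_transform_def eq integral_lborel_prod_vec[OF int_u] integral_u
    by (simp add: prod.distrib)
qed

theorem proposition3p3:
  fixes \<sigma> :: real and \<xi> :: "real ^ 'n::finite"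
  assumes "\<sigma> > 0"
  shows "fourier_transform (\<lambda>x. complex_of_real (texture_kernel \<sigma> x)) \<xi> =
    complex_of_real (- \<sigma> * (norm \<xi>)\<^sup>2 * exp (- (\<sigma>\<^sup>2 * (norm \<xi>)\<^sup>2) / 2))"
proof -
  have "fourier_transform (\<lambda>x. complex_of_real (texture_kernel \<sigma> x)) \<xi> =
    (LINT x|lborel. complex_of_real \<sigma> * (\<Sum>i\<in>UNIV.
      complex_of_real (partial_deriv i (partial_deriv i (gaussian_kernel \<sigma>)) x) *
      exp (- (\<i> * complex_of_real (x \<bullet> \<xi>)))))"
    by (simp add: fourier_transform_def texture_kernel_def laplacian_def sum_distrib_right mult.assoc)
  \<comment> \<open>Exchanging sum and integral uses integrability of each summand, since the
    Bochner integral is 0 on non-integrable functions and so not additive in general.\<close>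
  also have "\<dots> = complex_of_real \<sigma> * (\<Sum>i\<in>UNIV.
      fourier_transform (\<lambda>x. complex_of_real (partial_deriv i (partial_deriv i (gaussian_kernel \<sigma>)) x)) \<xi>)"
    unfolding fourier_transform_def
    using integrable_partial_deriv2_gaussian_kernel[OF assms]
    by (subst integral_mult_right_zero, subst Bochner_Integration.integral_sum) auto
  also have "\<dots> = complex_of_real (- \<sigma> * (\<Sum>i\<in>UNIV. (\<xi> $ i)\<^sup>2) * exp (- (\<sigma>\<^sup>2 * (norm \<xi>)\<^sup>2) / 2))"
    unfolding fourier_transform_partial_deriv2_gaussian_kernel[OF assms]
    by (simp add: sum_negf sum_distrib_right mult.assoc)
  also have "(\<Sum>i\<in>UNIV. (\<xi> $ i)\<^sup>2) = (norm \<xi>)\<^sup>2"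
    by (simp add: norm_vec_def L2_set_def sum_nonneg)
  finally show ?thesis .
qed

end
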